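(* Let $\mathscr{C}$ be a class of static algorithms solving a problem $\Pi$ with the property that for any algorithm in $\mathscr{C}$ for $q$ processing elements, all of its foldings on $q'$ processing elements, $2\le q'<q$, also belong to $\mathscr{C}$. Let $\mathcal{A}\in\mathscr{C}$ be a network-oblivious algorithm that is $(\alpha,p^\star)$-wise, for some $\alpha\in(0,1]$ and a power of two $p^\star$. Let $(\sigma^m_0,\dots,\sigma^m_{\log p^\star-1})$ and $(\sigma^M_0,\dots,\sigma^M_{\log p^\star-1})$ be two vectors of non-negative values with $\sigma^m_j\le\sigma^M_j$ for every $0\le j<\log p^\star$. Suppose that $\mathcal{A}$ is $\beta$-optimal on $M(2^j,\sigma)$ with respect to $\mathscr{C}$ for every $1\le j\le\log p^\star$ and every $\sigma$ with $\sigma^m_{j-1}\le\sigma\le\sigma^M_{j-1}$, where $0<\beta\le 1$. Then, for every power of two $p$ with $2\le p\le p^\star$, $\mathcal{A}$ is $\frac{\alpha\beta}{1+\alpha}$-optimal on D-BSP$(p,\boldsymbol{g},\boldsymbol{\ell})$ with respect to $\mathscr{C}$ as long as: (1) $g_i\ge g_{i+1}$ and $\ell_i/g_i\ge\ell_{i+1}/g_{i+1}$ for $0\le i<\log p-1$; (2) $\max_{1\le k\le\log p}\{\sigma^m_{k-1}2^k/p\}\le \ell_i/g_i\le\min_{1\le k\le\log p}\{\sigma^M_{k-1}2^k/p\}$ for $0\le i<\log p$.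
   Context: Conventions: $\log x$ means $\max\{1,\log_2 x\}$; numbers of processing elements are powers of two. Machine $M(v)$: $v$ processing elements (PEs) $P_0,\dots,P_{v-1}$, each a random access machine with unbounded local memory. An $M(v)$-algorithm runs as a sequence of supersteps, each with a label $i\in\{0,\dots,\log v-1\}$ (the label sequence is the same for all PEs). In an $i$-superstep each PE performs local computation and sends constant-size messages, only to PEs whose index agrees with its own in the $i$ most significant bits; the superstep ends with a barrier among such PEs, after which messages are available at their destinations. The algorithm is static if, for all inputs of the same size $n$, the number of supersteps, the sequence of labels, and the source-destination pairs of the messages of each superstep are the same. Folding: an $M(v)$-algorithm is executed on $M(p)$, $p<v$, by letting $P_j$ carry out the operations of the $v/p$ consecutively numbered PEs of $M(v)$ starting from the one with index $j(v/p)$. Supersteps with label $i<\log p$ keep their label; supersteps with label $i\ge\log p$ become local computation. For a static algorithm $\mathcal{A}$: $L^i_{\mathcal{A}}(n)$ is the set of $i$-supersteps, $S^i_{\mathcal{A}}(n)=|L^i_{\mathcal{A}}(n)|$; for $s\in L^i_{\mathcal{A}}(n)$, $i<\log p$, $h^s_{\mathcal{A}}(n,p)$ is the maximum number of messages sent by, or destined to, any processor in superstep $s$ when $\mathcal{A}$ is executed (folded) on $p$ processors (messages between PEs simulated by the same processor are not counted); $F^i_{\mathcal{A}}(n,p)=\sum_{s\in L^i_{\mathcal{A}}(n)}h^s_{\mathcal{A}}(n,p)$. Evaluation model $M(p,\sigma)$, $\sigma\ge0$: an $M(p)$ with communication complexity $H_{\mathcal{A}}(n,p,\sigma)=\sum_{i=0}^{\log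 p-1}\left(F^i_{\mathcal{A}}(n,p)+S^i_{\mathcal{A}}(n)\,\sigma\right)$. Execution model D-BSP$(p,\boldsymbol g,\boldsymbol\ell)$, with $\boldsymbol g=(g_0,\dots,g_{\log p-1})$, $g_i>0$, and $\boldsymbol\ell=(\ell_0,\dots,\ell_{\log p-1})$, $\ell_i\ge0$: an $M(p)$ with communication time $D_{\mathcal{A}}(n,p,\boldsymbol g,\boldsymbol\ell)=\sum_{i=0}^{\log p-1}\left(F^i_{\mathcal{A}}(n,p)g_i+S^i_{\mathcal{A}}(n)\ell_i\right)$. A network-oblivious algorithm is an algorithm specified on $M(v(n))$, where $v(n)$ depends only on the input size $n$; its execution on $M(p,\sigma)$ or D-BSP$(p,\boldsymbol g,\boldsymbol\ell)$, $p\le v(n)$, is by folding, and $H_{\mathcal A}$, $D_{\mathcal A}$ refer to the folded algorithm. $M(p,\sigma)$-algorithms and D-BSP-algorithms are $M(p)$-algorithms that may also depend on $p,\sigma$, resp. $p,\boldsymbol g,\boldsymbol\ell$. Optimality: for $0<\beta\le1$, an $M(p,\sigma)$-algorithm $\mathcal{B}\in\mathscr{C}$ is $\beta$-optimal on $M(p,\sigma)$ with respect to $\mathscr{C}$ if $H_{\mathcal{B}}(n,p,\sigma)\le\frac1\beta H_{\mathcal{B}'}(n,p,\sigma)$ for each $M(p,\sigma)$-algorithm $\mathcal{B}'\in\mathscr{C}$ and each $n$. Likewise, $\mathcal{B}\in\mathscr{C}$ is $\beta$-optimal on D-BSP$(p,\boldsymbol g,\boldsymbol\ell)$ with respect to $\mathscr{C}$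 if $D_{\mathcal{B}}(n,p,\boldsymbol g,\boldsymbol\ell)\le\frac1\beta D_{\mathcal{B}'}(n,p,\boldsymbol g,\boldsymbol\ell)$ for each D-BSP$(p,\boldsymbol g,\boldsymbol\ell)$-algorithm $\mathcal{B}'\in\mathscr{C}$ and each $n$. For a network-oblivious algorithm this refers to its folding. Wiseness: a static network-oblivious algorithm $\mathcal{A}$ specified on $M(v(n))$ is $(\alpha,p)$-wise, for $0<\alpha\le1$ and $1<p\le v(n)$, if $\sum_{i=0}^{j-1}F^i_{\mathcal{A}}(n,2^j)\ge\alpha\frac{p}{2^j}\sum_{i=0}^{j-1}F^i_{\mathcal{A}}(n,p)$ for every $1\le j\le\log p$ and every input size $n$. (Parameters such as $\alpha,\beta,p^\star,\sigma^m_j,\sigma^M_j$ may depend on $n$, all conditions being then read for that $n$.) *)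

theory Defs
  imports Complex_Main "HOL-Library.Multiset"
begin

definition is_pow2 :: "nat \<Rightarrow> bool" where
  "is_pow2 p \<longleftrightarrow> (\<exists>k. p = 2 ^ k)"

text \<open>The floor is exact on powers of two, to which \<open>lg\<close> is only ever applied.\<close>

definition lg :: "nat \<Rightarrow> nat" where
  "lg p = max 1 (nat \<lfloor>log 2 (real p)\<rfloor>)"

text \<open>
  A local memory is an unbounded array of words of an arbitrary type.  A message
  \<open>(d, a, w)\<close> carries a single word \<open>w\<close> to the PE with index \<open>d\<close>, where it becomes available
  at the address \<open>a\<close> chosen by the sender.
\<close>

type_synonym 'w mem = "nat \<Rightarrow> 'w"
type_synonym 'w msg = "nat \<times> nat \<times> 'w"
type_synonym 'w config = "nat \<Rightarrow> 'w mem"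

text \<open>
  \<open>code s r\<close> is the local computation of the PE with index \<open>r\<close> in the superstep \<open>s\<close>, together
  with the messages it sends.  Communication is the only cost ever measured, so local
  computation is an arbitrary function of the local memory.
\<close>

record 'w superstep =
  label :: nat
  code :: "nat \<Rightarrow> 'w mem \<Rightarrow> 'w mem \<times> 'w msg list"

text \<open>
  An algorithm prescribes, for every input size \<open>n\<close>, the number \<open>PEs A n\<close> of processing
  elements, the supersteps, and the local computation \<open>epilogue A n r\<close> that follows the last
  barrier.  The sequence of supersteps and labels is a function of \<open>n\<close> because only static
  algorithms are considered; the destinations of the messages may depend on the data, and
  \<open>static\<close> below excludes this.  \<open>load\<close> places an input in the local memories, and \<open>unload\<close>
  reads the output off the list of the final local memories.
\<close>

record ('i, 'o, 'w) algorithm =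
  PEs :: "nat \<Rightarrow> nat"
  load :: "'i \<Rightarrow> 'w config"
  supersteps :: "nat \<Rightarrow> 'w superstep list"
  epilogue :: "nat \<Rightarrow> nat \<Rightarrow> 'w mem \<Rightarrow> 'w mem"
  unload :: "nat \<Rightarrow> 'w mem list \<Rightarrow> 'o"

text \<open>
  The list \<open>rs\<close> names the PEs that take part.  It is the whole machine here, and a block of
  consecutive PEs when that block is simulated by one processor (see \<open>fold_algorithm\<close>).
  Messages to the same address of the same PE are written in the order of their sources.
\<close>

definition sent :: "nat list \<Rightarrow> 'w superstep \<Rightarrow> 'w config \<Rightarrow> 'w msg list" where
  "sent rs s c = concat (map (\<lambda>r. snd (code s r (c r))) rs)"

definition endpoints :: "nat list \<Rightarrow> 'w superstep \<Rightarrow> 'w config \<Rightarrow> (nat \<times> nat) multiset" where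
  "endpoints rs s c = mset (concat (map (\<lambda>r. map (\<lambda>m. (r, fst m)) (snd (code s r (c r)))) rs))"

definition compute :: "nat list \<Rightarrow> 'w superstep \<Rightarrow> 'w config \<Rightarrow> 'w config" where
  "compute rs s c = (\<lambda>r. if r \<in> set rs then fst (code s r (c r)) else c r)"

definition deliver :: "'w msg list \<Rightarrow> 'w config \<Rightarrow> 'w config" where
  "deliver = fold (\<lambda>(d, a, w) c. c(d := (c d)(a := w)))"

definition exec :: "nat list \<Rightarrow> 'w superstep \<Rightarrow> 'w config \<Rightarrow> 'w config" where
  "exec rs s c = deliver (sent rs s c) (compute rs s c)"

definition run :: "nat list \<Rightarrow> 'w superstep list \<Rightarrow> 'w config \<Rightarrow> 'w config" where
  "run rs = fold (exec rs)"

type_synonym pattern = "(nat \<times> (nat \<times> nat) multiset) list"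

fun trace :: "nat list \<Rightarrow> 'w superstep list \<Rightarrow> 'w config \<Rightarrow> pattern" where
  "trace rs [] c = []"
| "trace rs (s # ss) c = (label s, endpoints rs s c) # trace rs ss (exec rs s c)"

text \<open>In what follows, \<open>sz\<close> maps an input to its size.\<close>

definition alg_trace :: "('i \<Rightarrow> nat) \<Rightarrow> ('i, 'o, 'w) algorithm \<Rightarrow> 'i \<Rightarrow> pattern" where
  "alg_trace sz A x = trace [0..<PEs A (sz x)] (supersteps A (sz x)) (load A x)"

definition alg_output :: "('i \<Rightarrow> nat) \<Rightarrow> ('i, 'o, 'w) algorithm \<Rightarrow> 'i \<Rightarrow> 'o" where
  "alg_output sz A x =
    (let n = sz x; rs = [0..<PEs A n]; c = run rs (supersteps A n) (load A x)
     in unload A n (map (\<lambda>r. epilogue A n r (c r)) rs))"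

text \<open>
  The indices \<open>r\<close> and \<open>d\<close> below \<open>v\<close> have the same \<open>i\<close> most significant bits
  iff \<open>r div (v div 2 ^ i) = d div (v div 2 ^ i)\<close>.
\<close>

definition well_formed :: "('i \<Rightarrow> nat) \<Rightarrow> ('i, 'o, 'w) algorithm \<Rightarrow> bool" where
  "well_formed sz A \<longleftrightarrow>
     (\<forall>n. is_pow2 (PEs A n)) \<and>
     (\<forall>x. let v = PEs A (sz x) in
        \<forall>(i, M) \<in> set (alg_trace sz A x). i < lg v \<and>
          (\<forall>(r, d) \<in># M. d < v \<and> r div (v div 2 ^ i) = d div (v div 2 ^ i)))"

definition static :: "('i \<Rightarrow> nat) \<Rightarrow> ('i, 'o, 'w) algorithm \<Rightarrow> bool" where
  "static sz A \<longleftrightarrow> (\<forall>x y. sz x = sz y \<longrightarrow> alg_trace sz A x = alg_trace sz A y)"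

definition solves :: "('i \<Rightarrow> nat) \<Rightarrow> ('i \<Rightarrow> 'o \<Rightarrow> bool) \<Rightarrow> ('i, 'o, 'w) algorithm \<Rightarrow> bool" where
  "solves sz \<Pi> A \<longleftrightarrow> (\<forall>x. \<Pi> x (alg_output sz A x))"

definition on_PEs :: "nat \<Rightarrow> ('i, 'o, 'w) algorithm \<Rightarrow> bool" where
  "on_PEs q A \<longleftrightarrow> (\<forall>n. PEs A n = q)"

text \<open>
  A processor simulating \<open>b\<close> consecutive PEs stores cell \<open>a\<close> of the PE with index \<open>r\<close> in its
  own cell \<open>a * b + r mod b\<close>.  Only the memories of the simulated block are meaningful in
  \<open>unpack b m\<close>.
\<close>

definition unpack :: "nat \<Rightarrow> 'w mem \<Rightarrow> 'w config" where
  "unpack b m = (\<lambda>r a. m (a * b + r mod b))"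

definition pack :: "nat \<Rightarrow> nat \<Rightarrow> 'w config \<Rightarrow> 'w mem" where
  "pack b j c = (\<lambda>a. c (j * b + a mod b) (a div b))"

definition block :: "nat \<Rightarrow> nat \<Rightarrow> nat list" where
  "block b j = [j * b..<(j + 1) * b]"

text \<open>
  The superstep \<open>s\<close> preceded by the supersteps \<open>pre\<close>, which have become local computation.
  Messages of \<open>s\<close> that stay within a block turn into messages of a processor to itself; they
  are not counted by \<open>degree\<close> below.
\<close>

definition fold_superstep :: "nat \<Rightarrow> 'w superstep list \<Rightarrow> 'w superstep \<Rightarrow> 'w superstep" where
  "fold_superstep b pre s =
    \<lparr> label = label s,
      code = (\<lambda>j m. let rs = block b j; c = run rs pre (unpack b m)
        in (pack b j (compute rs s c),
            map (\<lambda>(d, a, w). (d div b, a * b + d mod b, w)) (sent rs s c))) \<rparr>"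

fun fold_supersteps ::
  "nat \<Rightarrow> nat \<Rightarrow> 'w superstep list \<Rightarrow> 'w superstep list \<Rightarrow> 'w superstep list" where
  "fold_supersteps p b pre [] = []"
| "fold_supersteps p b pre (s # ss) =
    (if label s < lg p then fold_superstep b pre s # fold_supersteps p b [] ss
     else fold_supersteps p b (pre @ [s]) ss)"

definition trailing :: "nat \<Rightarrow> 'w superstep list \<Rightarrow> 'w superstep list" where
  "trailing p ss = rev (takeWhile (\<lambda>s. lg p \<le> label s) (rev ss))"

text \<open>Meaningful for powers of two \<open>p\<close> with \<open>2 \<le> p \<le> PEs A n\<close>.\<close>

definition fold_algorithm :: "nat \<Rightarrow> ('i \<Rightarrow> nat) \<Rightarrow> ('i, 'o, 'w) algorithm \<Rightarrow> ('i, 'o, 'w) algorithm" where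
  "fold_algorithm p sz A =
    \<lparr> PEs = (\<lambda>n. p),
      load = (\<lambda>x j. pack (PEs A (sz x) div p) j (load A x)),
      supersteps = (\<lambda>n. fold_supersteps p (PEs A n div p) [] (supersteps A n)),
      epilogue = (\<lambda>n j m. let b = PEs A n div p;
           c = run (block b j) (trailing p (supersteps A n)) (unpack b m)
         in pack b j (\<lambda>r. epilogue A n r (c r))),
      unload = (\<lambda>n ms. let b = PEs A n div p
         in unload A n (map (\<lambda>r. unpack b (ms ! (r div b)) r) [0..<PEs A n])) \<rparr>"

text \<open>The common pattern of all runs of a static algorithm on inputs of size \<open>n\<close>.\<close>

definition comm :: "('i \<Rightarrow> nat) \<Rightarrow> ('i, 'o, 'w) algorithm \<Rightarrow> nat \<Rightarrow> pattern" where
  "comm sz A n = (THE t. \<forall>x. sz x = n \<longrightarrow> alg_trace sz A x = t)"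

definition L_alg :: "('i \<Rightarrow> nat) \<Rightarrow> ('i, 'o, 'w) algorithm \<Rightarrow> nat \<Rightarrow> nat \<Rightarrow> nat set" where
  "L_alg sz A i n = {s. s < length (comm sz A n) \<and> fst (comm sz A n ! s) = i}"

definition S_alg :: "('i \<Rightarrow> nat) \<Rightarrow> ('i, 'o, 'w) algorithm \<Rightarrow> nat \<Rightarrow> nat \<Rightarrow> nat" where
  "S_alg sz A i n = card (L_alg sz A i n)"

definition degree :: "nat \<Rightarrow> nat \<Rightarrow> (nat \<times> nat) multiset \<Rightarrow> nat" where
  "degree p b M = Max ((\<lambda>j. max
      (size {#(r, d) \<in># M. r div b = j \<and> d div b \<noteq> j#})
      (size {#(r, d) \<in># M. d div b = j \<and> r div b \<noteq> j#})) ` {..<p})"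

definition h_alg :: "('i \<Rightarrow> nat) \<Rightarrow> ('i, 'o, 'w) algorithm \<Rightarrow> nat \<Rightarrow> nat \<Rightarrow> nat \<Rightarrow> nat" where
  "h_alg sz A s n p = degree p (PEs A n div p) (snd (comm sz A n ! s))"

definition F_alg :: "('i \<Rightarrow> nat) \<Rightarrow> ('i, 'o, 'w) algorithm \<Rightarrow> nat \<Rightarrow> nat \<Rightarrow> nat \<Rightarrow> nat" where
  "F_alg sz A i n p = (\<Sum>s\<in>L_alg sz A i n. h_alg sz A s n p)"

definition H_alg :: "('i \<Rightarrow> nat) \<Rightarrow> ('i, 'o, 'w) algorithm \<Rightarrow> nat \<Rightarrow> nat \<Rightarrow> real \<Rightarrow> real" where
  "H_alg sz A n p \<sigma> = (\<Sum>i<lg p. real (F_alg sz A i n p) + real (S_alg sz A i n) * \<sigma>)"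

definition D_alg ::
  "('i \<Rightarrow> nat) \<Rightarrow> ('i, 'o, 'w) algorithm \<Rightarrow> nat \<Rightarrow> nat \<Rightarrow> (nat \<Rightarrow> real) \<Rightarrow> (nat \<Rightarrow> real) \<Rightarrow> real" where
  "D_alg sz A n p g l = (\<Sum>i<lg p. real (F_alg sz A i n p) * g i + real (S_alg sz A i n) * l i)"

text \<open>
  The following notions are stated for a fixed input size \<open>n\<close>, so that their parameters may
  depend on it.
\<close>

definition wise :: "('i \<Rightarrow> nat) \<Rightarrow> nat \<Rightarrow> real \<Rightarrow> nat \<Rightarrow> ('i, 'o, 'w) algorithm \<Rightarrow> bool" where
  "wise sz n \<alpha> p A \<longleftrightarrow>
     0 < \<alpha> \<and> \<alpha> \<le> 1 \<and> 1 < p \<and> p \<le> PEs A n \<and>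
     (\<forall>j\<in>{1..lg p}.
        real (\<Sum>i<j. F_alg sz A i n (2 ^ j)) \<ge> \<alpha> * (real p / 2 ^ j) * real (\<Sum>i<j. F_alg sz A i n p))"

text \<open>
  \<open>H_alg sz A n p \<sigma>\<close> and \<open>D_alg sz A n p g l\<close> are the costs of the folding of \<open>A\<close> on \<open>p\<close> processors,
  and \<open>A\<close> may be specified on more than \<open>p\<close> PEs; the competitors are the algorithms of the
  class specified on exactly \<open>p\<close> PEs.
\<close>

definition optimal_M :: "('i \<Rightarrow> nat) \<Rightarrow> nat \<Rightarrow> ('i, 'o, 'w) algorithm set \<Rightarrow> real \<Rightarrow>
    nat \<Rightarrow> real \<Rightarrow> ('i, 'o, 'w) algorithm \<Rightarrow> bool" where
  "optimal_M sz n \<C> \<beta> p \<sigma> A \<longleftrightarrow>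
     A \<in> \<C> \<and> 0 < \<beta> \<and> \<beta> \<le> 1 \<and>
     (\<forall>B\<in>\<C>. on_PEs p B \<longrightarrow> H_alg sz A n p \<sigma> \<le> 1 / \<beta> * H_alg sz B n p \<sigma>)"

definition optimal_DBSP :: "('i \<Rightarrow> nat) \<Rightarrow> nat \<Rightarrow> ('i, 'o, 'w) algorithm set \<Rightarrow> real \<Rightarrow>
    nat \<Rightarrow> (nat \<Rightarrow> real) \<Rightarrow> (nat \<Rightarrow> real) \<Rightarrow> ('i, 'o, 'w) algorithm \<Rightarrow> bool" where
  "optimal_DBSP sz n \<C> \<beta> p g l A \<longleftrightarrow>
     A \<in> \<C> \<and> 0 < \<beta> \<and> \<beta> \<le> 1 \<and>
     (\<forall>B\<in>\<C>. on_PEs p B \<longrightarrow> D_alg sz A n p g l \<le> 1 / \<beta> * D_alg sz B n p g l)"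

end

theory Submission
  imports Defs
begin

text \<open>
  Let \<open>B\<close> be a competitor on \<open>p\<close> processors and let \<open>r\<close> be one of the ratios \<open>l k / g k\<close>.
  By the second condition on \<open>g\<close> and \<open>l\<close>, \<open>A\<close> is \<open>\<beta>\<close>-optimal on \<open>M(2^j, r p / 2^j)\<close>, in particular
  against the folding of \<open>B\<close> on \<open>2^j\<close> processors.  Folding from \<open>p\<close> to \<open>2^j\<close> processors increases
  the degree of a superstep by a factor of at most \<open>p / 2^j\<close>, and for \<open>A\<close> wiseness reverses this up
  to \<open>\<alpha>\<close>.  Hence, for every \<open>j\<close>, the sum of \<open>\<alpha> F\<^sub>A + r S\<^sub>A\<close> over the labels below \<open>j\<close>, with degrees
  taken on \<open>p\<close> processors, is at most \<open>1 / \<beta>\<close> times the sum of \<open>F\<^sub>B + r S\<^sub>B\<close>.  Summation by parts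
  turns inequalities between prefix sums into inequalities between sums with decreasing weights.
  With the smallest ratio \<open>r\<close> and the weights \<open>g\<close> this bounds the \<open>F\<close>-part of \<open>D\<^sub>A\<close> by
  \<open>D\<^sub>B / (\<alpha> \<beta>)\<close>; with the largest \<open>r\<close> and the weights \<open>l\<close> it bounds the \<open>S\<close>-part by \<open>D\<^sub>B / \<beta>\<close>.
\<close>

section \<open>Folding preserves the communication pattern\<close>

text \<open>The configuration of the simulated machine that is stored in the memories \<open>c\<close> of the
  processors simulating \<open>b\<close> consecutive PEs each.\<close>

definition view :: "nat \<Rightarrow> 'w config \<Rightarrow> 'w config" where
  "view b c = (\<lambda>r. unpack b (c (r div b)) r)"

definition fold_msg :: "nat \<Rightarrow> 'w msg \<Rightarrow> 'w msg" where
  "fold_msg b = (\<lambda>(d, a, w). (d div b, a * b + d mod b, w))"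

text \<open>Messages within a block remain as pairs \<open>(j, j)\<close>, which
  \<open>degree\<close> does not count.\<close>

definition fold_pattern :: "nat \<Rightarrow> nat \<Rightarrow> pattern \<Rightarrow> pattern" where
  "fold_pattern k b t = map (\<lambda>(i, M). (i, {#(r div b, d div b). (r, d) \<in># M#}))
     (filter (\<lambda>(i, M). i < k) t)"

text \<open>The memory layout of the simulation is injective: no two cells of simulated PEs share a
  cell of a processor.\<close>

lemma div_mod_unique:
  fixes a a' d d' b :: nat
  assumes "b > 0" "d' div b = d div b" "a' * b + d' mod b = a * b + d mod b"
  shows "d' = d" "a' = a"
proof -
  have "(a' * b + d' mod b) div b = (a * b + d mod b) div b"
    using assms(3) by simp
  then show "a' = a"
    using assms(1) by simp
  then show "d' = d"
    using assms(2,3) div_mult_mod_eq[of d b] div_mult_mod_eq[of d' b] by simp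
qed

lemma deliver_Cons: "deliver ((d, a, w) # ms) c = deliver ms (c(d := (c d)(a := w)))"
  by (simp add: deliver_def)

text \<open>By injectivity of the layout a folded message changes exactly one simulated cell, so the
  writes carry over one by one, in the same order.\<close>

lemma view_deliver:
  assumes b: "b > 0"
  shows "view b (deliver (map (fold_msg b) ms) c) = deliver ms (view b c)"
proof (induction ms arbitrary: c)
  case Nil
  show ?case by (simp add: deliver_def)
next
  case (Cons m ms)
  obtain d a w where m: "m = (d, a, w)" by (cases m)
  let ?c = "c(d div b := (c (d div b))(a * b + d mod b := w))"
  have view_upd: "view b ?c = (view b c)(d := (view b c d)(a := w))"
  proof (intro ext)
    fix r e
    show "view b ?c r e = ((view b c)(d := (view b c d)(a := w))) r e"
    proof (cases "r div b = d div b \<and> e * b + r mod b = a * b + d mod b")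
      case True
      then have "r = d" "e = a" using div_mod_unique[OF b, of r d e a] by simp_all
      then show ?thesis by (simp add: view_def unpack_def)
    qed (auto simp: view_def unpack_def)
  qed
  have "view b (deliver (map (fold_msg b) (m # ms)) c) = view b (deliver (map (fold_msg b) ms) ?c)"
    by (simp add: m fold_msg_def deliver_Cons)
  also have "\<dots> = deliver ms (view b ?c)"
    by (rule Cons.IH)
  also have "\<dots> = deliver (m # ms) (view b c)"
    by (simp only: view_upd m deliver_Cons)
  finally show ?case .
qed

lemma view_pack:
  assumes "b > 0"
  shows "view b (\<lambda>j. pack b j (C j)) r = C (r div b) r"
  using assms by (simp add: view_def unpack_def pack_def)

section \<open>Executing a block of PEs on its own\<close>

lemma in_block:
  assumes "b > 0"
  shows "r \<in> set (block b j) \<longleftrightarrow> r div b = j"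
  using assms by (auto simp: block_def div_nat_eqI algebra_simps dividend_less_times_div
      less_eq_div_iff_mult_less_eq)

text \<open>Stated for lists rather than multisets, because the order of the sources decides which
  of two writes to the same address prevails.\<close>

lemma concat_map_blocks:
  "concat (map f [0..<p * b]) = concat (map (\<lambda>j. concat (map f (block b j))) [0..<p])"
proof (induction p)
  case (Suc p)
  have "[0..<Suc p * b] = [0..<p * b] @ block b p"
    using upt_add_eq_append[of 0 "p * b" b] by (simp add: block_def algebra_simps)
  then show ?case using Suc by simp
qed simp

lemma sent_cong:
  assumes "\<And>r. r \<in> set rs \<Longrightarrow> c r = c' r"
  shows "sent rs s c = sent rs s c'"
  using assms by (simp add: sent_def cong: map_cong)

text \<open>Makes delivery local: two deliveries can be compared one PE at a time, through the
  messages addressed to it.\<close>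

lemma deliver_apply:
  "deliver ms c d = fold (\<lambda>(_, a, w) m. m(a := w)) (filter (\<lambda>m. fst m = d) ms) (c d)"
  by (induction ms arbitrary: c) (auto simp: deliver_def)

text \<open>Split the PEs into those before, in and after the block. Those outside send only within
  their own blocks, so none of their messages reaches \<open>d\<close>.\<close>

lemma filter_sent_block:
  assumes b: "b > 0" and j: "j < p" and d: "d \<in> set (block b j)"
    and stays: "\<And>r m. r < p * b \<Longrightarrow> m \<in> set (snd (code s r (c r))) \<Longrightarrow> fst m div b = r div b"
  shows "filter (\<lambda>m. fst m = d) (sent [0..<p * b] s c) =
         filter (\<lambda>m. fst m = d) (sent (block b j) s c)"
proof -
  have le: "(j + 1) * b \<le> p * b" using j by (intro mult_le_mono1) simp
  have split: "[k..<k''] = [k..<k'] @ [k'..<k'']" if "k \<le> k'" "k' \<le> k''" for k k' k''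
    using upt_add_eq_append[of k k' "k'' - k'"] that by simp
  have "[0..<p * b] = [0..<j * b] @ block b j @ [(j + 1) * b..<p * b]"
    unfolding block_def
    using le split[of 0 "j * b" "p * b", OF _ mult_le_mono1] split[of "j * b" "(j + 1) * b" "p * b"] j
    by simp
  then have *: "sent [0..<p * b] s c =
      sent [0..<j * b] s c @ sent (block b j) s c @ sent [(j + 1) * b..<p * b] s c"
    by (simp add: sent_def)
  have empty: "filter (\<lambda>m. fst m = d) (sent rs s c) = []"
    if "\<And>r. r \<in> set rs \<Longrightarrow> r < p * b \<and> r div b \<noteq> j" for rs
  proof -
    have "fst m \<noteq> d" if m: "m \<in> set (sent rs s c)" for m
    proof -
      obtain r where "r \<in> set rs" "m \<in> set (snd (code s r (c r)))"
        using m by (auto simp: sent_def)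
      then have "r div b \<noteq> j" "fst m div b = r div b"
        using \<open>\<And>r. r \<in> set rs \<Longrightarrow> r < p * b \<and> r div b \<noteq> j\<close> stays by blast+
      moreover have "d div b = j"
        using d in_block[OF b] by simp
      ultimately show ?thesis by auto
    qed
    then show ?thesis by (simp add: filter_empty_conv)
  qed
  have "filter (\<lambda>m. fst m = d) (sent [0..<j * b] s c) = []"
  proof (rule empty)
    fix r assume "r \<in> set [0..<j * b]"
    then show "r < p * b \<and> r div b \<noteq> j"
      using le in_block[OF b, of r j] by (auto simp: block_def)
  qed
  moreover have "filter (\<lambda>m. fst m = d) (sent [(j + 1) * b..<p * b] s c) = []"
  proof (rule empty)
    fix r assume "r \<in> set [(j + 1) * b..<p * b]"
    then show "r < p * b \<and> r div b \<noteq> j"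
      using le in_block[OF b, of r j] by (auto simp: block_def)
  qed
  ultimately show ?thesis by (simp add: *)
qed

lemma exec_block:
  assumes b: "b > 0" and j: "j < p" and d: "d \<in> set (block b j)"
    and stays: "\<And>r m. r < p * b \<Longrightarrow> m \<in> set (snd (code s r (c r))) \<Longrightarrow> fst m div b = r div b"
    and agree: "\<And>r. r \<in> set (block b j) \<Longrightarrow> c' r = c r"
  shows "exec (block b j) s c' d = exec [0..<p * b] s c d"
proof -
  have "d < p * b"
    using d j in_block[OF b] by (auto simp: div_less_iff_less_mult b)
  then have "compute (block b j) s c' d = compute [0..<p * b] s c d"
    using d agree by (simp add: compute_def)
  moreover have "sent (block b j) s c' = sent (block b j) s c"
    using agree by (rule sent_cong)
  ultimately show ?thesis
    using filter_sent_block[OF b j d, of s c] stays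
    by (simp add: exec_def deliver_apply)
qed

text \<open>The invariant of the simulation. The processors hold \<open>c'\<close> and have yet to
  execute \<open>pre\<close>; the simulated machine has already executed it and is in
  \<open>c\<close>. Agreement is asked of each block only for its own PEs, since
  \<open>unpack\<close> is meaningless elsewhere.\<close>

context
  fixes b p :: nat and pre :: "'w superstep list" and s :: "'w superstep"
    and c c' :: "'w config"
  assumes b: "b > 0"
    and agree: "\<And>r. r < p * b \<Longrightarrow>
      run (block b (r div b)) pre (unpack b (c' (r div b))) r = c r"
begin

lemma agree_block:
  assumes "j < p" "r \<in> set (block b j)"
  shows "run (block b j) pre (unpack b (c' j)) r = c r"
  using assms agree[of r] in_block[OF b, of r j] by (auto simp: div_less_iff_less_mult b)

lemma sent_block:
  assumes "j < p"
  shows "sent (block b j) s (run (block b j) pre (unpack b (c' j))) = sent (block b j) s c"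
  using assms by (intro sent_cong agree_block)

lemma sent_fold_superstep:
  "sent [0..<p] (fold_superstep b pre s) c' = map (fold_msg b) (sent [0..<p * b] s c)"
proof -
  have "sent [0..<p] (fold_superstep b pre s) c' =
      concat (map (\<lambda>j. map (fold_msg b) (sent (block b j) s c)) [0..<p])"
    unfolding sent_def[of "[0..<p]"]
    by (intro arg_cong[of _ _ concat] map_cong refl)
       (simp add: fold_superstep_def Let_def sent_block fold_msg_def)
  then show ?thesis
    by (simp add: sent_def concat_map_blocks map_concat comp_def)
qed

lemma endpoints_fold_superstep:
  "endpoints [0..<p] (fold_superstep b pre s) c' =
   {#(r div b, d div b). (r, d) \<in># endpoints [0..<p * b] s c#}"
proof -
  have "map (\<lambda>m. (j, fst m)) (snd (code (fold_superstep b pre s) j (c' j))) =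
      concat (map (\<lambda>r. map (\<lambda>m. (r div b, fst m div b)) (snd (code s r (c r)))) (block b j))"
    if "j < p" for j
  proof -
    have "map (\<lambda>m. (j, fst m)) (snd (code (fold_superstep b pre s) j (c' j))) =
        map (\<lambda>m. (j, fst m div b)) (sent (block b j) s c)"
      using that by (simp add: fold_superstep_def Let_def sent_block case_prod_unfold)
    also have "\<dots> = concat (map (\<lambda>r. map (\<lambda>m. (j, fst m div b)) (snd (code s r (c r)))) (block b j))"
      by (simp add: sent_def map_concat comp_def)
    also have "\<dots> =
        concat (map (\<lambda>r. map (\<lambda>m. (r div b, fst m div b)) (snd (code s r (c r)))) (block b j))"
      by (intro arg_cong[of _ _ concat] map_cong refl) (simp add: in_block[OF b])
    finally show ?thesis .
  qed
  then have "endpoints [0..<p] (fold_superstep b pre s) c' =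
      mset (concat (map (\<lambda>j. concat (map (\<lambda>r. map (\<lambda>m. (r div b, fst m div b))
        (snd (code s r (c r)))) (block b j))) [0..<p]))"
    unfolding endpoints_def
    by (intro arg_cong[of _ _ "\<lambda>xss. mset (concat xss)"] map_cong refl) auto
  also have "\<dots> = mset (concat (map (\<lambda>r. map (\<lambda>m. (r div b, fst m div b))
        (snd (code s r (c r)))) [0..<p * b]))"
    by (simp only: concat_map_blocks)
  also have "\<dots> = {#(r div b, d div b). (r, d) \<in># endpoints [0..<p * b] s c#}"
    by (simp add: endpoints_def map_concat comp_def flip: mset_map)
  finally show ?thesis .
qed

text \<open>After a superstep that survives the folding, the invariant holds again with nothing
  pending.\<close>

lemma view_exec_fold_superstep:
  assumes r: "r < p * b"
  shows "view b (exec [0..<p] (fold_superstep b pre s) c') r = exec [0..<p * b] s c r"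
proof -
  let ?C = "\<lambda>j. compute (block b j) s (run (block b j) pre (unpack b (c' j)))"
  have rb: "r div b < p" using r b by (simp add: div_less_iff_less_mult)
  have "view b (compute [0..<p] (fold_superstep b pre s) c') r = view b (\<lambda>j. pack b j (?C j)) r"
    using rb by (simp add: view_def compute_def fold_superstep_def Let_def)
  also have "\<dots> = compute [0..<p * b] s c r"
    using r agree[OF r] in_block[OF b] by (simp add: view_pack[OF b] compute_def)
  finally show ?thesis
    by (simp add: exec_def sent_fold_superstep view_deliver[OF b] deliver_apply)
qed

end

text \<open>Induction along the supersteps, with the pending list and both configurations
  generalised. The last assumption lets blocks run the absorbed supersteps without
  communication.\<close>

lemma trace_fold_supersteps:
  assumes b: "b > 0"
    and "\<And>r. r < p * b \<Longrightarrow> run (block b (r div b)) pre (unpack b (c' (r div b))) r = c r"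
    and "\<And>i M r d. (i, M) \<in> set (trace [0..<p * b] ss c) \<Longrightarrow> lg p \<le> i \<Longrightarrow> (r, d) \<in># M \<Longrightarrow>
      d div b = r div b"
  shows "trace [0..<p] (fold_supersteps p b pre ss) c' =
         fold_pattern (lg p) b (trace [0..<p * b] ss c)"
  using assms(2-)
proof (induction ss arbitrary: pre c c')
  case Nil
  show ?case by (simp add: fold_pattern_def)
next
  case (Cons s ss)
  note agree = Cons.prems(1)
  show ?case
  proof (cases "label s < lg p")
    case True
    have "trace [0..<p] (fold_supersteps p b [] ss) (exec [0..<p] (fold_superstep b pre s) c') =
        fold_pattern (lg p) b (trace [0..<p * b] ss (exec [0..<p * b] s c))"
    proof (rule Cons.IH)
      fix r assume "r < p * b"
      from view_exec_fold_superstep[where s = s, OF b agree this]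
      show "run (block b (r div b)) [] (unpack b (exec [0..<p] (fold_superstep b pre s) c' (r div b))) r
          = exec [0..<p * b] s c r"
        by (simp add: view_def run_def)
    qed (use Cons.prems(2) in auto)
    then show ?thesis
      using True endpoints_fold_superstep[OF b agree]
      by (simp add: fold_pattern_def) (simp add: fold_superstep_def)
  next
    \<comment> \<open>The superstep joins the pending list. The processors stay in \<open>c'\<close>
      while the simulated machine advances, and \<open>exec_block\<close> preserves the
      invariant.\<close>
    case False
    have stays: "fst m div b = r div b" if "r < p * b" "m \<in> set (snd (code s r (c r)))" for r m
      using False that by (intro Cons.prems(2)[of "label s" "endpoints [0..<p * b] s c"])
        (auto simp: endpoints_def)
    have "trace [0..<p] (fold_supersteps p b (pre @ [s]) ss) c' =
        fold_pattern (lg p) b (trace [0..<p * b] ss (exec [0..<p * b] s c))"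
    proof (rule Cons.IH)
      fix r assume r: "r < p * b"
      then have rp: "r div b < p" using b by (simp add: div_less_iff_less_mult)
      have "exec (block b (r div b)) s (run (block b (r div b)) pre (unpack b (c' (r div b)))) r =
          exec [0..<p * b] s c r"
        using stays agree_block[OF b agree rp]
        by (intro exec_block[OF b rp]) (auto simp: in_block[OF b])
      then show "run (block b (r div b)) (pre @ [s]) (unpack b (c' (r div b))) r =
          exec [0..<p * b] s c r"
        by (simp add: run_def)
    qed (use Cons.prems(2) in auto)
    then show ?thesis using False by (simp add: fold_pattern_def)
  qed
qed

section \<open>Patterns and costs of folded algorithms\<close>

lemma lg_pow2: "k \<ge> 1 \<Longrightarrow> lg (2 ^ k) = k"
  by (simp add: lg_def log_nat_power)

lemma div_eq_coarsen:
  fixes r d b b' :: nat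
  assumes "r div b = d div b" "b dvd b'"
  shows "r div b' = d div b'"
  using assms by (metis div_mult2_eq dvdE)

text \<open>An input of size \<open>n\<close> is essential: without one, every pattern would satisfy
  the description in \<open>comm\<close>.\<close>

lemma comm_eq:
  assumes "static sz A" "sz x = n"
  shows "comm sz A n = alg_trace sz A x"
  unfolding comm_def using assms by (intro the_equality) (auto simp: static_def)

lemma alg_trace_fold:
  assumes wf: "well_formed sz B" and PEs: "PEs B (sz x) = 2 ^ m" and j: "1 \<le> j" "j \<le> m"
  shows "alg_trace sz (fold_algorithm (2 ^ j) sz B) x = fold_pattern j (2 ^ (m - j)) (alg_trace sz B x)"
proof -
  let ?b = "2 ^ (m - j) :: nat"
  have v: "2 ^ j * ?b = 2 ^ m"
    using j by (simp flip: power_add)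
  have b: "2 ^ m div 2 ^ j = ?b"
    using j by (simp add: power_diff)
  \<comment> \<open>A message of label \<open>i\<close> stays in a block of
    \<open>2 ^ (m - i)\<close> PEs, and for \<open>j \<le> i\<close> these blocks are nested in
    those of size \<open>?b\<close>.\<close>
  have local: "d div ?b = r div ?b"
    if "(i, M) \<in> set (trace [0..<2 ^ j * ?b] (supersteps B (sz x)) (load B x))" "j \<le> i" "(r, d) \<in># M"
    for i M r d
  proof -
    have "(i, M) \<in> set (alg_trace sz B x)" using that v by (simp add: alg_trace_def PEs)
    then have i: "i < lg (2 ^ m)" and "r div (2 ^ m div 2 ^ i) = d div (2 ^ m div 2 ^ i)"
      using wf that(3) by (fastforce simp: well_formed_def Let_def PEs)+
    moreover have "2 ^ m div 2 ^ i = (2 ^ (m - i) :: nat)"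
      using i j by (simp add: lg_pow2 power_diff)
    ultimately show ?thesis
      using that(2) div_eq_coarsen[of r "2 ^ (m - i)" d ?b] by (simp add: le_imp_power_dvd)
  qed
  have "trace [0..<2 ^ j] (fold_supersteps (2 ^ j) ?b [] (supersteps B (sz x)))
      (\<lambda>k. pack ?b k (load B x)) =
    fold_pattern (lg (2 ^ j)) ?b (trace [0..<2 ^ j * ?b] (supersteps B (sz x)) (load B x))"
  proof (rule trace_fold_supersteps)
    fix r assume "r < 2 ^ j * ?b"
    show "run (block ?b (r div ?b)) [] (unpack ?b (pack ?b (r div ?b) (load B x))) r = load B x r"
      using view_pack[of ?b "\<lambda>_. load B x" r] by (simp add: run_def view_def)
  qed (use local j in \<open>auto simp: lg_pow2\<close>)
  then show ?thesis
    using j by (simp add: alg_trace_def fold_algorithm_def PEs b v lg_pow2)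
qed

lemma degree_fold: "degree p 1 {#(r div b, d div b). (r, d) \<in># M#} = degree p b M"
  by (simp add: degree_def filter_mset_image_mset case_prod_unfold comp_def)

text \<open>Folding deletes supersteps and so shifts their positions; a sum over a filtered list is
  insensitive to this.\<close>

lemma F_alg_sum_list:
  "F_alg sz A i n p =
   (\<Sum>(_, M)\<leftarrow>filter (\<lambda>(k, M). k = i) (comm sz A n). degree p (PEs A n div p) M)"
proof -
  let ?t = "comm sz A n"
  have "F_alg sz A i n p =
      (\<Sum>s<length ?t. if fst (?t ! s) = i then degree p (PEs A n div p) (snd (?t ! s)) else 0)"
    unfolding F_alg_def L_alg_def h_alg_def by (simp add: sum.If_cases Int_def lessThan_def)
  also have "\<dots> = (\<Sum>(k, M)\<leftarrow>?t. if k = i then degree p (PEs A n div p) M else 0)"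
    by (simp add: sum.list_conv_set_nth case_prod_unfold atLeast0LessThan sum_list_sum_nth)
  also have "\<dots> = (\<Sum>(_, M)\<leftarrow>filter (\<lambda>(k, M). k = i) ?t. degree p (PEs A n div p) M)"
    by (simp add: sum_list_map_filter' case_prod_unfold)
  finally show ?thesis .
qed

lemma S_alg_length: "S_alg sz A i n = length (filter (\<lambda>(k, M). k = i) (comm sz A n))"
  by (simp add: S_alg_def L_alg_def length_filter_conv_card case_prod_unfold)

lemma filter_fold_pattern:
  assumes "i < k"
  shows "filter (\<lambda>(k, M). k = i) (fold_pattern k b t) =
    map (\<lambda>(i, M). (i, {#(r div b, d div b). (r, d) \<in># M#})) (filter (\<lambda>(k, M). k = i) t)"
  using assms by (induction t) (auto simp: fold_pattern_def)

text \<open>Optimality compares only with algorithms specified on exactly \<open>2 ^ j\<close> PEs.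
  This lets the folding of a competitor stand in for it: the cost reads only labels below
  \<open>j\<close>, which folding keeps.\<close>

lemma H_alg_fold:
  assumes wf: "well_formed sz B" and B: "static sz B" "static sz (fold_algorithm (2 ^ j) sz B)"
    and n: "n \<in> range sz" and PEs: "PEs B n = 2 ^ m" and j: "1 \<le> j" "j \<le> m"
  shows "H_alg sz (fold_algorithm (2 ^ j) sz B) n (2 ^ j) \<sigma> = H_alg sz B n (2 ^ j) \<sigma>"
proof -
  let ?B = "fold_algorithm (2 ^ j) sz B"
  obtain x where x: "sz x = n" using n by auto
  have comm: "comm sz ?B n = fold_pattern j (2 ^ (m - j)) (comm sz B n)"
    using alg_trace_fold[OF wf, of x m j] PEs j x by (simp add: comm_eq B)
  have "PEs ?B n div 2 ^ j = 1" "PEs B n div 2 ^ j = 2 ^ (m - j)"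
    using j by (simp_all add: fold_algorithm_def PEs power_diff)
  then have "F_alg sz ?B i n (2 ^ j) = F_alg sz B i n (2 ^ j) \<and> S_alg sz ?B i n = S_alg sz B i n"
    if "i < j" for i
    using degree_fold unfolding F_alg_sum_list S_alg_length comm filter_fold_pattern[OF that]
    by (simp add: comp_def case_prod_unfold)
  then show ?thesis
    using j by (simp add: H_alg_def lg_pow2)
qed

section \<open>Folding onto fewer processors\<close>

lemma size_filter_div_block:
  fixes f :: "'a \<Rightarrow> nat"
  assumes b: "b > 0" and k: "k > 0"
  shows "size {#e \<in># M. f e div (b * k) = j \<and> Q e#} =
         (\<Sum>i\<in>{j * k..<(j + 1) * k}. size {#e \<in># M. f e div b = i \<and> Q e#})"
proof (induction M)
  case (add e M)
  have "f e div (b * k) = j \<longleftrightarrow> f e div b \<in> {j * k..<(j + 1) * k}"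
    using in_block[OF k, of "f e div b" j] by (simp add: block_def div_mult2_eq)
  moreover have "size {#x \<in># add_mset e M. f x div b = i \<and> Q x#} =
      (if f e div b = i then if Q e then 1 else 0 else 0) + size {#x \<in># M. f x div b = i \<and> Q x#}" for i
    by simp
  ultimately show ?case using add by (simp add: sum.distrib)
qed simp

text \<open>A coarse block consists of \<open>k\<close> fine ones, and a message that leaves the
  coarse block also leaves its fine block.\<close>

lemma degree_coarsen:
  assumes b: "b > 0" and k: "k > 0" and p: "p > 0"
  shows "degree p (b * k) M \<le> k * degree (p * k) b M"
proof -
  \<comment> \<open>Taking \<open>fst\<close> and \<open>snd\<close> for \<open>f\<close> and
    \<open>f'\<close>, in either order, covers both sent and received messages.\<close>
  have bound: "size {#e \<in># M. f e div (b * k) = j \<and> f' e div (b * k) \<noteq> j#} \<le> k * degree (p * k) b M"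
    if j: "j < p" and *: "\<And>i. i < p * k \<Longrightarrow>
      size {#e \<in># M. f e div b = i \<and> f' e div b \<noteq> i#} \<le> degree (p * k) b M"
    for j and f f' :: "nat \<times> nat \<Rightarrow> nat"
  proof -
    have "(j + 1) * k \<le> p * k" using j by (intro mult_le_mono1) simp
    moreover have "size {#e \<in># M. f e div b = i \<and> f' e div (b * k) \<noteq> j#} \<le>
        size {#e \<in># M. f e div b = i \<and> f' e div b \<noteq> i#}" if "i \<in> {j * k..<(j + 1) * k}" for i
      using that in_block[OF k, of i j]
      by (intro size_mset_mono) (auto simp: block_def div_mult2_eq intro!: filter_mset_mono_strong)
    ultimately have "size {#e \<in># M. f e div (b * k) = j \<and> f' e div (b * k) \<noteq> j#} \<le>
        (\<Sum>i\<in>{j * k..<(j + 1) * k}. degree (p * k) b M)"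
      unfolding size_filter_div_block[OF b k]
      by (intro sum_mono) (fastforce intro: order_trans[OF _ *])
    then show ?thesis by simp
  qed
  have *: "size {#e \<in># M. fst e div b = i \<and> snd e div b \<noteq> i#} \<le> degree (p * k) b M"
      "size {#e \<in># M. snd e div b = i \<and> fst e div b \<noteq> i#} \<le> degree (p * k) b M"
    if "i < p * k" for i
  proof -
    have "max (size {#(r, d) \<in># M. r div b = i \<and> d div b \<noteq> i#})
        (size {#(r, d) \<in># M. d div b = i \<and> r div b \<noteq> i#}) \<le> degree (p * k) b M"
      unfolding degree_def using that by (intro Max_ge) auto
    then show "size {#e \<in># M. fst e div b = i \<and> snd e div b \<noteq> i#} \<le> degree (p * k) b M"
      "size {#e \<in># M. snd e div b = i \<and> fst e div b \<noteq> i#} \<le> degree (p * k) b M"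
      by (simp_all add: case_prod_unfold)
  qed
  show ?thesis
    unfolding degree_def[of p] case_prod_unfold
    using p bound[of _ fst snd] bound[of _ snd fst] * by (subst Max_le_iff) auto
qed

lemma F_alg_coarsen:
  assumes PEs: "PEs A n = 2 ^ v" and "j \<le> m" "m \<le> v"
  shows "F_alg sz A i n (2 ^ j) \<le> 2 ^ (m - j) * F_alg sz A i n (2 ^ m)"
proof -
  have "2 ^ v div 2 ^ j = (2 ^ (v - j) :: nat)" "2 ^ v div 2 ^ m = (2 ^ (v - m) :: nat)"
    using assms(2,3) by (simp_all add: power_diff)
  moreover have "2 ^ m = (2 ^ j * 2 ^ (m - j) :: nat)" "2 ^ (v - j) = (2 ^ (v - m) * 2 ^ (m - j) :: nat)"
    using assms(2,3) by (simp_all flip: power_add)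
  ultimately have "h_alg sz A s n (2 ^ j) \<le> 2 ^ (m - j) * h_alg sz A s n (2 ^ m)" for s
    using degree_coarsen[of "2 ^ (v - m)" "2 ^ (m - j)" "2 ^ j"] by (simp add: h_alg_def PEs)
  then show ?thesis
    by (simp add: F_alg_def sum_distrib_left sum_mono)
qed

section \<open>From the evaluation model to the execution model\<close>

lemma sum_antimono_weights_nonpos:
  fixes w x :: "nat \<Rightarrow> real"
  assumes "\<And>i. i + 1 < L \<Longrightarrow> w (i + 1) \<le> w i" and "\<And>i. i < L \<Longrightarrow> 0 \<le> w i"
    and "\<And>j. 1 \<le> j \<Longrightarrow> j \<le> L \<Longrightarrow> (\<Sum>i<j. x i) \<le> 0"
  shows "(\<Sum>i<L. w i * x i) \<le> 0"
proof -
  \<comment> \<open>Summation by parts as an induction: lowering the weight of a nonpositive prefix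
    sum can only increase the product.\<close>
  have le: "(\<Sum>i<Suc k. w i * x i) \<le> w k * (\<Sum>i<Suc k. x i)" if "k < L" for k
    using that
  proof (induction k)
    case (Suc k)
    have "w k * (\<Sum>i<Suc k. x i) \<le> w (Suc k) * (\<Sum>i<Suc k. x i)"
      using Suc.prems assms(1)[of k] assms(3)[of "Suc k"] by (intro mult_right_mono_neg) auto
    moreover have "(\<Sum>i<Suc k. w i * x i) \<le> w k * (\<Sum>i<Suc k. x i)"
      using Suc by simp
    ultimately show ?case
      by (simp add: sum.lessThan_Suc[of _ "Suc k"] distrib_left del: sum.lessThan_Suc)
  qed simp
  show ?thesis
  proof (cases L)
    case (Suc k)
    have "w k * (\<Sum>i<Suc k. x i) \<le> 0"
      using assms(2)[of k] assms(3)[of "Suc k"] Suc by (intro mult_nonneg_nonpos) auto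
    then show ?thesis
      using le[of k] Suc by simp
  qed simp
qed

lemma antimono_below:
  fixes f :: "nat \<Rightarrow> real"
  assumes "\<And>i. i + 1 < L \<Longrightarrow> f (i + 1) \<le> f i" "i \<le> j" "j < L"
  shows "f j \<le> f i"
  using assms(2,3)
proof (induction j rule: dec_induct)
  case (step k)
  then show ?case using assms(1)[of k] by simp
qed simp

lemma weighted_cost_le:
  fixes F S F' S' g l :: "nat \<Rightarrow> real"
  assumes L: "L \<ge> 1" and \<alpha>: "0 < \<alpha>" and \<beta>: "0 < \<beta>"
    and nonneg: "\<And>i. 0 \<le> F i" "\<And>i. 0 \<le> S i" "\<And>i. 0 \<le> F' i" "\<And>i. 0 \<le> S' i"
    and g: "\<And>i. i < L \<Longrightarrow> 0 < g i" and l: "\<And>i. i < L \<Longrightarrow> 0 \<le> l i"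
    and anti_g: "\<And>i. i + 1 < L \<Longrightarrow> g (i + 1) \<le> g i"
    and anti_r: "\<And>i. i + 1 < L \<Longrightarrow> l (i + 1) / g (i + 1) \<le> l i / g i"
    and prefix: "\<And>j k. 1 \<le> j \<Longrightarrow> j \<le> L \<Longrightarrow> k < L \<Longrightarrow>
      (\<Sum>i<j. \<alpha> * F i + S i * (l k / g k)) \<le> 1 / \<beta> * (\<Sum>i<j. F' i + S' i * (l k / g k))"
  shows "(\<Sum>i<L. F i * g i + S i * l i) \<le> (1 + \<alpha>) / (\<alpha> * \<beta>) * (\<Sum>i<L. F' i * g i + S' i * l i)"
proof -
  define r where "r i = l i / g i" for i
  let ?D = "\<Sum>i<L. F' i * g i + S' i * l i"
  have r0: "0 \<le> r i" and lr: "l i = r i * g i" if "i < L" for i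
    using that g[of i] l[of i] by (simp_all add: r_def)
  have anti: "r j \<le> r i" if "i \<le> j" "j < L" for i j
    using antimono_below[of L r, OF _ that] anti_r by (simp add: r_def)
  have F: "\<alpha> * (\<Sum>i<L. F i * g i) \<le> 1 / \<beta> * ?D"
  proof -
    \<comment> \<open>With the smallest ratio, \<open>?r * g i \<le> l i\<close> for every
      \<open>i\<close>, so the competitor's superstep term stays within its share of
      \<open>?D\<close>.\<close>
    let ?r = "r (L - 1)"
    have "(\<Sum>i<L. g i * (\<alpha> * F i - 1 / \<beta> * (F' i + S' i * ?r))) \<le> 0"
    proof (rule sum_antimono_weights_nonpos)
      fix j assume j: "1 \<le> j" "j \<le> L"
      have "(\<Sum>i<j. \<alpha> * F i) \<le> (\<Sum>i<j. \<alpha> * F i + S i * ?r)"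
        using r0[of "L - 1"] L nonneg by (intro sum_mono) simp
      also have "\<dots> \<le> 1 / \<beta> * (\<Sum>i<j. F' i + S' i * ?r)"
        using prefix[OF j, of "L - 1"] L by (simp add: r_def)
      finally show "(\<Sum>i<j. \<alpha> * F i - 1 / \<beta> * (F' i + S' i * ?r)) \<le> 0"
        by (simp add: sum_subtractf sum_distrib_left)
    qed (use g anti_g in \<open>auto intro: less_imp_le\<close>)
    then have "\<alpha> * (\<Sum>i<L. F i * g i) \<le> 1 / \<beta> * (\<Sum>i<L. F' i * g i + S' i * (?r * g i))"
      by (simp add: sum_subtractf sum_distrib_left algebra_simps)
    also have "\<dots> \<le> 1 / \<beta> * ?D"
      using \<beta> nonneg g anti by (intro mult_left_mono sum_mono add_left_mono)
        (auto simp: lr intro!: mult_right_mono less_imp_le[OF g])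
    finally show ?thesis .
  qed
  have S: "(\<Sum>i<L. S i * l i) \<le> 1 / \<beta> * ?D"
  \<comment> \<open>The largest ratio is cancelled at the end, so zero is treated apart; then all of
    \<open>l\<close> vanishes.\<close>
  proof (cases "r 0 = 0")
    case True
    have "l i = 0" if "i < L" for i
      using anti[of 0 i] r0[of i] lr[of i] True that by simp
    then show ?thesis
      using \<beta> nonneg g by (auto intro!: divide_nonneg_pos sum_nonneg mult_nonneg_nonneg less_imp_le[OF g])
  next
    case False
    then have r: "0 < r 0" using r0[of 0] L by simp
    have "(\<Sum>i<L. l i * (S i * r 0 - 1 / \<beta> * (F' i + S' i * r 0))) \<le> 0"
    proof (rule sum_antimono_weights_nonpos)
      fix j assume j: "1 \<le> j" "j \<le> L"
      have "(\<Sum>i<j. S i * r 0) \<le> (\<Sum>i<j. \<alpha> * F i + S i * r 0)"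
        using \<alpha> nonneg by (intro sum_mono) simp
      also have "\<dots> \<le> 1 / \<beta> * (\<Sum>i<j. F' i + S' i * r 0)"
        using prefix[OF j, of 0] L by (simp add: r_def)
      finally show "(\<Sum>i<j. S i * r 0 - 1 / \<beta> * (F' i + S' i * r 0)) \<le> 0"
        by (simp add: sum_subtractf sum_distrib_left)
    next
      fix i assume "i + 1 < L"
      then show "l (i + 1) \<le> l i"
        using anti[of i "i + 1"] anti_g[of i] g[of "i + 1"] r0[of i] lr
        by (simp add: mult_mono less_imp_le)
    qed (use l in auto)
    then have "r 0 * (\<Sum>i<L. S i * l i) \<le> 1 / \<beta> * (\<Sum>i<L. F' i * l i + S' i * l i * r 0)"
      by (simp add: sum_subtractf sum_distrib_left algebra_simps)
    \<comment> \<open>Since \<open>r 0\<close> is the largest ratio,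
      \<open>l i \<le> r 0 * g i\<close>.\<close>
    also have "\<dots> \<le> 1 / \<beta> * (\<Sum>i<L. F' i * (r 0 * g i) + S' i * l i * r 0)"
      using \<beta> nonneg anti by (intro mult_left_mono sum_mono add_right_mono)
        (auto simp: lr intro!: mult_right_mono less_imp_le[OF g])
    also have "\<dots> = r 0 * (1 / \<beta> * ?D)"
      by (simp add: sum_distrib_left algebra_simps)
    finally show ?thesis using r by (simp only: mult_le_cancel_left_pos)
  qed
  have "(\<Sum>i<L. F i * g i + S i * l i) = 1 / \<alpha> * (\<alpha> * (\<Sum>i<L. F i * g i)) + (\<Sum>i<L. S i * l i)"
    using \<alpha> by (simp add: sum.distrib)
  also have "\<dots> \<le> 1 / \<alpha> * (1 / \<beta> * ?D) + 1 / \<beta> * ?D"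
    using \<alpha> by (intro add_mono mult_left_mono F S) auto
  also have "\<dots> = (1 + \<alpha>) / (\<alpha> * \<beta>) * ?D"
    using \<alpha> \<beta> by (simp add: field_simps)
  finally show ?thesis .
qed

section \<open>Optimality on the D-BSP\<close>

theorem theorem1:
  fixes sz :: "'i \<Rightarrow> nat"
    and \<Pi> :: "'i \<Rightarrow> 'o \<Rightarrow> bool"
    and \<C> :: "('i, 'o, 'w) algorithm set"
    and A :: "('i, 'o, 'w) algorithm"
    and n pstar p :: nat
    and \<alpha> \<beta> :: real
    and \<sigma>m \<sigma>M g l :: "nat \<Rightarrow> real"
  assumes members: "\<And>B. B \<in> \<C> \<Longrightarrow> well_formed sz B \<and> static sz B \<and> solves sz \<Pi> B"
    and closed: "\<And>B q q'. B \<in> \<C> \<Longrightarrow> on_PEs q B \<Longrightarrow> is_pow2 q' \<Longrightarrow> 2 \<le> q' \<Longrightarrow> q' < q \<Longrightarrow>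
      fold_algorithm q' sz B \<in> \<C>"
    and input_size: "n \<in> range sz"
    and A: "A \<in> \<C>"
    and alpha: "0 < \<alpha>" "\<alpha> \<le> 1"
    and pstar: "is_pow2 pstar"
    and wise: "wise sz n \<alpha> pstar A"
    and sigma_nonneg: "\<And>j. j < lg pstar \<Longrightarrow> 0 \<le> \<sigma>m j \<and> 0 \<le> \<sigma>M j"
    and sigma_le: "\<And>j. j < lg pstar \<Longrightarrow> \<sigma>m j \<le> \<sigma>M j"
    and beta: "0 < \<beta>" "\<beta> \<le> 1"
    and optimal: "\<And>j \<sigma>. 1 \<le> j \<Longrightarrow> j \<le> lg pstar \<Longrightarrow> \<sigma>m (j - 1) \<le> \<sigma> \<Longrightarrow> \<sigma> \<le> \<sigma>M (j - 1) \<Longrightarrow>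
      optimal_M sz n \<C> \<beta> (2 ^ j) \<sigma> A"
    and p: "is_pow2 p" "2 \<le> p" "p \<le> pstar"
    and g_pos: "\<And>i. i < lg p \<Longrightarrow> 0 < g i"
    and l_nonneg: "\<And>i. i < lg p \<Longrightarrow> 0 \<le> l i"
    and cond1: "\<And>i. i + 1 < lg p \<Longrightarrow> g i \<ge> g (i + 1) \<and> l i / g i \<ge> l (i + 1) / g (i + 1)"
    and cond2: "\<And>i. i < lg p \<Longrightarrow>
      Max ((\<lambda>k. \<sigma>m (k - 1) * 2 ^ k / real p) ` {1..lg p}) \<le> l i / g i \<and>
      l i / g i \<le> Min ((\<lambda>k. \<sigma>M (k - 1) * 2 ^ k / real p) ` {1..lg p})"
  shows "optimal_DBSP sz n \<C> (\<alpha> * \<beta> / (1 + \<alpha>)) p g l A"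
proof -
  obtain m where pm: "p = 2 ^ m" using p(1) by (auto simp: is_pow2_def)
  obtain K where K: "pstar = 2 ^ K" using pstar by (auto simp: is_pow2_def)
  obtain v where v: "PEs A n = 2 ^ v" using members[OF A] by (auto simp: well_formed_def is_pow2_def)
  have m: "1 \<le> m" using p(2) pm by (cases m) auto
  have mK: "m \<le> K" using p(3) pm K by simp
  have Kv: "K \<le> v" using wise K v by (simp add: wise_def)
  have lgs: "lg p = m" "lg pstar = K" using m mK by (simp_all add: pm K lg_pow2)
  let ?F = "\<lambda>B i. real (F_alg sz B i n p)"
  let ?S = "\<lambda>B i. real (S_alg sz B i n)"
  \<comment> \<open>Wiseness passes from \<open>pstar\<close> to \<open>p\<close> with the same
    \<alpha>: degrees on \<open>p\<close> processors are at most \<open>2 ^ (K - m)\<close> times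
    those on \<open>pstar\<close>.\<close>
  have wise_p: "\<alpha> * (\<Sum>i<j. ?F A i) * 2 ^ (m - j) \<le> real (\<Sum>i<j. F_alg sz A i n (2 ^ j))"
    if j: "1 \<le> j" "j \<le> m" for j
  proof -
    have "(\<Sum>i<j. F_alg sz A i n p) \<le> 2 ^ (K - m) * (\<Sum>i<j. F_alg sz A i n pstar)"
      using F_alg_coarsen[OF v mK Kv] by (simp add: pm K sum_distrib_left sum_mono)
    from of_nat_mono[OF this, where 'a = real]
    have "(\<Sum>i<j. ?F A i) \<le> 2 ^ (K - m) * real (\<Sum>i<j. F_alg sz A i n pstar)"
      by simp
    then have "\<alpha> * 2 ^ (m - j) * (\<Sum>i<j. ?F A i) \<le>
        \<alpha> * 2 ^ (m - j) * (2 ^ (K - m) * real (\<Sum>i<j. F_alg sz A i n pstar))"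
      using alpha by (intro mult_left_mono) auto
    also have "\<dots> = \<alpha> * (real pstar / 2 ^ j) * real (\<Sum>i<j. F_alg sz A i n pstar)"
      using j mK by (simp add: K power_diff)
    also have "\<dots> \<le> real (\<Sum>i<j. F_alg sz A i n (2 ^ j))"
      using wise j mK lgs by (simp add: wise_def)
    finally show ?thesis by (simp add: mult_ac)
  qed
  have main: "D_alg sz A n p g l \<le> (1 + \<alpha>) / (\<alpha> * \<beta>) * D_alg sz B n p g l"
    if B: "B \<in> \<C>" "on_PEs p B" for B
    unfolding D_alg_def lgs
  proof (rule weighted_cost_le)
    fix j k assume j: "1 \<le> j" "j \<le> m" and k: "k < m"
    \<comment> \<open>Passing between \<open>p\<close> and \<open>2 ^ j\<close> processors scales
      degrees by \<open>?q\<close>; taking \<open>?r * ?q\<close> as the superstep cost lets this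
      factor cancel throughout.\<close>
    let ?r = "l k / g k" and ?q = "2 ^ (m - j) :: real"
    have pj: "real p / 2 ^ j = ?q" using j by (simp add: pm power_diff)
    have "\<sigma>m (j - 1) * 2 ^ j / real p \<le> ?r" "?r \<le> \<sigma>M (j - 1) * 2 ^ j / real p"
      using cond2[of k] k j by (simp_all add: lgs)
    moreover have "x * y / z \<le> r \<longleftrightarrow> x \<le> r * (z / y)" "r \<le> x * y / z \<longleftrightarrow> r * (z / y) \<le> x"
      if "0 < y" "0 < z" for x y z r :: real
      using that by (simp_all add: field_simps)
    ultimately have "\<sigma>m (j - 1) \<le> ?r * (real p / 2 ^ j)" "?r * (real p / 2 ^ j) \<le> \<sigma>M (j - 1)"
      using p(2) by simp_all
    then have "optimal_M sz n \<C> \<beta> (2 ^ j) (?r * ?q) A"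
      using optimal[of j "?r * ?q"] j mK by (simp add: lgs pj)
    moreover have "\<exists>B'\<in>\<C>. on_PEs (2 ^ j) B' \<and> H_alg sz B' n (2 ^ j) (?r * ?q) = H_alg sz B n (2 ^ j) (?r * ?q)"
    \<comment> \<open>The class is closed only under proper foldings; for \<open>j = m\<close> the
      competitor itself serves.\<close>
    proof (cases "j = m")
      case True
      then show ?thesis using B pm by auto
    next
      case False
      let ?B = "fold_algorithm (2 ^ j) sz B"
      have "?B \<in> \<C>"
        using B(2) j False self_le_power[of "2::nat" j]
        by (intro closed[OF B(1)]) (auto simp: pm is_pow2_def)
      moreover have "H_alg sz ?B n (2 ^ j) (?r * ?q) = H_alg sz B n (2 ^ j) (?r * ?q)"
        using members[OF B(1)] members[OF \<open>?B \<in> \<C>\<close>] input_size j B(2) pm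
        by (intro H_alg_fold[of _ _ _ _ m]) (auto simp: on_PEs_def)
      ultimately show ?thesis by (intro bexI[of _ ?B]) (auto simp: on_PEs_def fold_algorithm_def)
    qed
    ultimately have opt: "H_alg sz A n (2 ^ j) (?r * ?q) \<le> 1 / \<beta> * H_alg sz B n (2 ^ j) (?r * ?q)"
      unfolding optimal_M_def by metis
    have "?q * (\<Sum>i<j. \<alpha> * ?F A i + ?S A i * ?r) =
        \<alpha> * (\<Sum>i<j. ?F A i) * ?q + (\<Sum>i<j. ?S A i * (?r * ?q))"
      by (simp add: sum.distrib sum_distrib_left distrib_left mult_ac)
    also have "\<dots> \<le> H_alg sz A n (2 ^ j) (?r * ?q)"
      using wise_p[OF j] j by (simp add: H_alg_def lg_pow2 sum.distrib)
    also have "\<dots> \<le> 1 / \<beta> * H_alg sz B n (2 ^ j) (?r * ?q)" by (rule opt)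
    also have "\<dots> \<le> 1 / \<beta> * (?q * (\<Sum>i<j. ?F B i + ?S B i * ?r))"
    proof (intro mult_left_mono)
      have "real (F_alg sz B i n (2 ^ j)) \<le> ?q * ?F B i" for i
        using F_alg_coarsen[of B n m j m sz i] B(2) j pm
        by (auto simp: on_PEs_def dest: of_nat_mono[where 'a = real])
      then show "H_alg sz B n (2 ^ j) (?r * ?q) \<le> ?q * (\<Sum>i<j. ?F B i + ?S B i * ?r)"
        using j by (simp add: H_alg_def lg_pow2 sum_distrib_left distrib_left mult_ac sum_mono)
    qed (use beta in auto)
    finally have "?q * (\<Sum>i<j. \<alpha> * ?F A i + ?S A i * ?r) \<le>
        ?q * (1 / \<beta> * (\<Sum>i<j. ?F B i + ?S B i * ?r))"
      by (simp only: mult.left_commute)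
    then show "(\<Sum>i<j. \<alpha> * ?F A i + ?S A i * ?r) \<le> 1 / \<beta> * (\<Sum>i<j. ?F B i + ?S B i * ?r)"
      by (rule mult_left_le_imp_le) simp
  qed (use m alpha beta g_pos l_nonneg cond1 lgs in auto)
  \<comment> \<open>The optimality factor must not exceed 1.\<close>
  have "\<alpha> * \<beta> \<le> 1 + \<alpha>"
    using alpha beta mult_left_le[of \<beta> \<alpha>] by linarith
  then show ?thesis
    unfolding optimal_DBSP_def using A alpha beta main by auto
qed

end
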